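(* Let $\mathbb F$ be the field of real numbers or the field of complex numbers, let $\mathcal M_2(\mathbb F)$ be the algebra of $2\times 2$ matrices over $\mathbb F$ with identity matrix $I$, and let $k\geq 1$ be an integer. Let $\Phi:\mathcal M_2(\mathbb F)\to\mathcal M_2(\mathbb F)$ be a map (not assumed linear or additive) whose range contains all rank one matrices. Then $[\Phi(A),\Phi(B)]_k=[A,B]_k$ for all $A,B\in\mathcal M_2(\mathbb F)$ if and only if there exist a functional $h:\mathcal M_2(\mathbb F)\to\mathbb F$ and a scalar $\lambda\in\mathbb F$ with $\lambda^{k+1}=1$ such that $\Phi(A)=\lambda A+h(A)I$ for all $A\in\mathcal M_2(\mathbb F)$.
   Context: For elements $A,B$ of an algebra, the $k$-commutator is defined recursively by $[A,B]_0=A$, $[A,B]_1=[A,B]=AB-BA$, and $[A,B]_k=[[A,B]_{k-1},B]$ for $k\ge 1$. A map $\Phi$ satisfying $[\Phi(A),\Phi(B)]_k=[A,B]_k$ for all $A,B$ is called strong $k$-commutativity preserving. Here "functional" means an arbitrary scalar-valued function, with no linearity assumed. *)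

theory Defs
  imports "HOL-Analysis.Analysis"
begin

(* Type class multiplication on vectors is componentwise; the matrix product is **. *)
primrec k_commutator :: "nat \<Rightarrow> 'a::comm_ring_1^'n^'n \<Rightarrow> 'a^'n^'n \<Rightarrow> 'a^'n^'n" where
  "k_commutator 0 A B = A"
| "k_commutator (Suc k) A B = k_commutator k A B ** B - B ** k_commutator k A B"

definition strong_k_commutativity_preserving ::
    "nat \<Rightarrow> ('a::comm_ring_1^'n^'n \<Rightarrow> 'a^'n^'n) \<Rightarrow> bool" where
  "strong_k_commutativity_preserving k \<Phi> \<longleftrightarrow>
     (\<forall>A B. k_commutator k (\<Phi> A) (\<Phi> B) = k_commutator k A B)"

(* On matrices, *s would act row-wise with a vector of scalars, and scaleR only takes real scalars. *)
definition matrix_scale :: "'a::comm_ring_1 \<Rightarrow> 'a^'n^'m \<Rightarrow> 'a^'n^'m" (infixr "*\<^sub>M" 75) where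
  "c *\<^sub>M A = map_matrix ((*) c) A"

end

(* The trace form makes the k-commutator with B skew- or self-adjoint, so
   tr (Phi B [A,B]_k) = tr (Phi B [Phi A, Phi B]_k) = 0 for all A gives [Phi B, B]_k = 0.
   For an idempotent B this forces Phi B to commute with B, hence Phi B = l B + c I in size two.
   Since [.,B]_k is additive and Phi takes all rank one idempotents as values, Phi is linear modulo
   scalar matrices. The algebra is spanned by I and three rank one idempotents, and comparing
   Phi on affine combinations of these that are again idempotent shows that l is the same for all. *)
theory Submission
  imports Defs
begin

section \<open>Scalar multiples and k-commutators\<close>

lemma matrix_scale_nth [simp]: "(c *\<^sub>M A) $ i $ j = c * A $ i $ j"
  by (simp add: matrix_scale_def)

lemma matrix_scale_zero [simp]: "c *\<^sub>M 0 = 0"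
  by (simp add: vec_eq_iff)

lemma matrix_scale_mult_left: "(c *\<^sub>M A) ** B = c *\<^sub>M (A ** B)"
  by (simp add: vec_eq_iff matrix_matrix_mult_def sum_distrib_left mult.assoc)

lemma matrix_scale_mult_right: "A ** (c *\<^sub>M B) = c *\<^sub>M (A ** B)"
  by (simp add: vec_eq_iff matrix_matrix_mult_def sum_distrib_left mult.left_commute)

lemma matrix_scale_scale: "a *\<^sub>M b *\<^sub>M A = (a * b) *\<^sub>M A"
  by (simp add: vec_eq_iff mult.assoc)

lemma matrix_scale_diff: "c *\<^sub>M (A - B) = c *\<^sub>M A - c *\<^sub>M B"
  by (simp add: vec_eq_iff right_diff_distrib)

lemma matrix_mul_add_left: "(A + B) ** C = A ** C + B ** C"
  for A :: "'a::comm_ring_1^'n^'m"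
  by (simp add: vec_eq_iff matrix_matrix_mult_def sum.distrib distrib_right)

lemma matrix_mul_diff_left: "(A - B) ** C = A ** C - B ** C"
  for A :: "'a::comm_ring_1^'n^'m"
  by (simp add: vec_eq_iff matrix_matrix_mult_def sum_subtractf left_diff_distrib)

lemma matrix_mul_diff_right: "C ** (A - B) = C ** A - C ** B"
  for A :: "'a::comm_ring_1^'n^'m"
  by (simp add: vec_eq_iff matrix_matrix_mult_def sum_subtractf right_diff_distrib)

lemma k_commutator_add_left:
  "k_commutator k (A + B) C = k_commutator k A C + k_commutator k B C"
  by (induction k) (simp_all add: matrix_mul_add_left matrix_add_ldistrib)

lemma k_commutator_diff_left:
  "k_commutator k (A - B) C = k_commutator k A C - k_commutator k B C"
  by (induction k) (simp_all add: matrix_mul_diff_left matrix_mul_diff_right)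

lemma k_commutator_scale_left:
  "k_commutator k (c *\<^sub>M A) B = c *\<^sub>M k_commutator k A B"
  by (induction k)
    (simp_all add: matrix_scale_mult_left matrix_scale_mult_right matrix_scale_diff)

lemma k_commutator_zero_left [simp]: "k_commutator k 0 B = 0"
  using k_commutator_diff_left[of k 0 0 B] by simp

text \<open>The definition adds brackets on the outside. Peeling off the innermost one instead lets
  inductions replace \<open>A\<close> by its commutator with \<open>B\<close>.\<close>

lemma k_commutator_Suc_left:
  "k_commutator (Suc k) A B = k_commutator k (A ** B - B ** A) B"
  by (induction k) auto

lemma k_commutator_eq_0_if_commute:
  assumes "k \<ge> 1" "A ** B = B ** A"
  shows "k_commutator k A B = 0"
proof -
  obtain m where "k = Suc m"
    using assms(1) by (cases k) auto
  then show ?thesis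
    using assms(2) by (simp only: k_commutator_Suc_left diff_self k_commutator_zero_left)
qed

lemma k_commutator_mat_1_left: "k \<ge> 1 \<Longrightarrow> k_commutator k (mat 1) B = 0"
  by (simp add: k_commutator_eq_0_if_commute)

text \<open>For every \<open>X\<close> the commutator of \<open>X\<close> with
  \<open>l B + c I\<close> is \<open>l\<close> times that with \<open>B\<close>, so each of the
  \<open>k\<close> brackets contributes one factor \<open>l\<close>.\<close>

lemma k_commutator_affine_right:
  "k_commutator k A (l *\<^sub>M B + c *\<^sub>M mat 1) = l ^ k *\<^sub>M k_commutator k A B"
proof (induction k)
  case (Suc k)
  have "X ** (l *\<^sub>M B + c *\<^sub>M mat 1) - (l *\<^sub>M B + c *\<^sub>M mat 1) ** X = l *\<^sub>M (X ** B - B ** X)"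
    for X
    by (simp add: matrix_mul_add_left matrix_add_ldistrib matrix_scale_mult_left
        matrix_scale_mult_right matrix_scale_diff)
  then show ?case
    by (simp add: Suc.IH matrix_scale_mult_left matrix_scale_mult_right matrix_scale_scale
        mult.commute flip: matrix_scale_diff)
qed (simp add: vec_eq_iff)

lemma strong_k_commutativity_preserving_affine:
  assumes "k \<ge> 1" "l ^ (k + 1) = 1" "\<And>A. \<Phi> A = l *\<^sub>M A + h A *\<^sub>M mat 1"
  shows "strong_k_commutativity_preserving k \<Phi>"
proof -
  \<comment> \<open>The factor \<open>l ^ k\<close> comes from the right argument and the single
    \<open>l\<close> from the left one.\<close>
  have "l ^ k * (l * x) = x" for x
    using assms(2) by (metis Suc_eq_plus1 mult.assoc mult_1 power_Suc2)
  then show ?thesis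
    by (simp add: strong_k_commutativity_preserving_def assms(3) k_commutator_affine_right
        k_commutator_add_left k_commutator_scale_left k_commutator_mat_1_left[OF assms(1)] vec_eq_iff)
qed

lemma k_commutator_idempotent:
  assumes "P ** P = P" "k \<ge> 1" "k_commutator k A P = 0"
  shows "A ** P = P ** A"
  using assms(2,3)
proof (induction k rule: dec_induct)
  case base
  then show ?case by simp
next
  case (step k)
  \<comment> \<open>Writing \<open>k\<close> as a successor displays
    \<open>k_commutator k A P\<close> as a commutator with \<open>P\<close>.\<close>
  obtain m where m: "k = Suc m"
    using step.hyps by (cases k) auto
  have PP: "P ** (P ** Y) = P ** Y" for Y
    by (simp add: matrix_mul_assoc assms(1))
  \<comment> \<open>A commutator with \<open>P\<close> is reproduced by taking the commutator with \<open>P\<close> twice more.\<close>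
  have "k_commutator k A P = k_commutator (Suc (Suc k)) A P"
    by (simp only: m k_commutator.simps matrix_mul_diff_left matrix_mul_diff_right
        matrix_mul_assoc[symmetric] assms(1) PP) simp
  also have "\<dots> = 0"
    using step.prems by (simp only: k_commutator.simps) simp
  finally show ?case by (rule step.IH)
qed

section \<open>The trace form\<close>

text \<open>Cyclicity of the trace moves one bracket with \<open>B\<close> from one factor to the
  other at the cost of a sign; this is done \<open>k\<close> times.\<close>

lemma trace_k_commutator:
  "trace (Y ** k_commutator k A B) = (-1) ^ k * trace (k_commutator k Y B ** A)"
proof (induction k arbitrary: A)
  case (Suc k)
  have skew: "trace (Z ** (A ** B - B ** A)) = - trace ((Z ** B - B ** Z) ** A)" for Z
    by (simp add: matrix_mul_diff_left matrix_mul_diff_right trace_sub matrix_mul_assoc)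
      (metis matrix_mul_assoc trace_mul_sym)
  have "trace (Y ** k_commutator (Suc k) A B)
      = (-1) ^ k * trace (k_commutator k Y B ** (A ** B - B ** A))"
    by (simp only: k_commutator_Suc_left Suc.IH)
  then show ?case
    by (simp only: skew k_commutator.simps) simp
qed (simp)

lemma trace_form_nondegenerate:
  fixes A :: "'a::comm_ring_1^'n^'n"
  assumes "\<And>B. trace (A ** B) = 0"
  shows "A = 0"
proof -
  have "A $ i $ j = 0" for i j
  proof -
    \<comment> \<open>The test matrix is the matrix unit with its 1 in row \<open>j\<close> and
      column \<open>i\<close>; its trace pairing with \<open>A\<close> is the entry
      \<open>A $ i $ j\<close>.\<close>
    have "trace (A ** (\<chi> a b. if a = j \<and> b = i then 1 else 0)) = (\<Sum>a\<in>UNIV. if a = i then A $ a $ j else 0)"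
      unfolding trace_def matrix_matrix_mult_def
      by (rule sum.cong) (auto simp: if_distrib cong: if_cong)
    with assms show ?thesis by simp
  qed
  then show ?thesis by (simp add: vec_eq_iff)
qed

lemma strong_preserving_k_commutator_image_self:
  fixes \<Phi> :: "'a::comm_ring_1^'n^'n \<Rightarrow> 'a^'n^'n"
  assumes "strong_k_commutativity_preserving k \<Phi>" "k \<ge> 1"
  shows "k_commutator k (\<Phi> B) B = 0"
proof (rule trace_form_nondegenerate)
  fix A
  have "(-1) ^ k * trace (k_commutator k (\<Phi> B) B ** A)
      = trace (\<Phi> B ** k_commutator k A B)"
    by (simp only: trace_k_commutator)
  also have "\<dots> = trace (\<Phi> B ** k_commutator k (\<Phi> A) (\<Phi> B))"
    using assms(1) by (simp add: strong_k_commutativity_preserving_def)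
  also have "\<dots> = (-1) ^ k * trace (k_commutator k (\<Phi> B) (\<Phi> B) ** \<Phi> A)"
    by (simp only: trace_k_commutator)
  also have "\<dots> = 0"
    using assms(2) by (simp add: k_commutator_eq_0_if_commute trace_def)
  \<comment> \<open>The sign cancels over any commutative ring, because it squares to 1.\<close>
  finally show "trace (k_commutator k (\<Phi> B) B ** A) = 0"
    by (metis left_minus_one_mult_self mult_zero_right)
qed

section \<open>Two by two matrices\<close>

definition mat2 :: "'a::zero \<Rightarrow> 'a \<Rightarrow> 'a \<Rightarrow> 'a \<Rightarrow> 'a^2^2" where
  "mat2 a b c d = vector [vector [a, b], vector [c, d]]"

lemma mat2_nth [simp]:
  "mat2 a b c d $ 1 $ 1 = a" "mat2 a b c d $ 1 $ 2 = b"
  "mat2 a b c d $ 2 $ 1 = c" "mat2 a b c d $ 2 $ 2 = d"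
  by (simp_all add: mat2_def)

lemma mat_2_nth [simp]:
  "(mat x :: 'a::zero^2^2) $ 1 $ 1 = x" "(mat x :: 'a^2^2) $ 1 $ 2 = 0"
  "(mat x :: 'a^2^2) $ 2 $ 1 = 0" "(mat x :: 'a^2^2) $ 2 $ 2 = x"
  by (simp_all add: mat_def)

lemmas matrix_2_simps = vec_eq_iff forall_2 matrix_matrix_mult_def sum_2

lemma mat2_rank_1:
  "rank (mat2 1 b 0 0 :: 'a::field^2^2) = 1" "rank (mat2 1 0 c 0 :: 'a::field^2^2) = 1"
proof -
  \<comment> \<open>The second row is a multiple of the nonzero first row, which is therefore a
    basis of the row space.\<close>
  have *: "rank A = 1" if "row 1 A \<noteq> 0" "row 2 A = x *s row 1 A" for A :: "'a^2^2" and x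
    unfolding row_rank_def_gen
  proof (rule vec.dim_unique[of "{row 1 A}"])
    show "{row 1 A} \<subseteq> rows A"
      by (auto simp: rows_def)
    have "row i A \<in> vec.span {row 1 A}" for i
      using exhaust_2[of i] that(2) by (auto intro: vec.span_base vec.span_scale[OF vec.span_base])
    then show "rows A \<subseteq> vec.span {row 1 A}"
      by (auto simp: rows_def)
  qed (use that in simp_all)
  show "rank (mat2 1 b 0 0 :: 'a^2^2) = 1"
    by (rule *[of _ 0]) (simp_all add: row_def vec_eq_iff forall_2)
  show "rank (mat2 1 0 c 0 :: 'a^2^2) = 1"
    by (rule *[of _ c]) (simp_all add: row_def vec_eq_iff forall_2)
qed

text \<open>The matrix unit is an eigenvector, for eigenvalue -1, of bracketing with the idempotent,
  so this k-commutator never vanishes in a field.\<close>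

lemma k_commutator_mat2:
  "k_commutator k (mat2 0 1 0 0) (mat2 1 0 0 0) = (-1) ^ k *\<^sub>M mat2 0 1 0 (0::'a::comm_ring_1)"
  by (induction k) (simp_all add: matrix_2_simps)

lemma commute_mat2_imp_affine:
  fixes A :: "'a::comm_ring_1^2^2"
  shows "A ** mat2 1 b 0 0 = mat2 1 b 0 0 ** A \<Longrightarrow>
      \<exists>l c. A = l *\<^sub>M mat2 1 b 0 0 + c *\<^sub>M mat 1"
    and "A ** mat2 1 0 b 0 = mat2 1 0 b 0 ** A \<Longrightarrow>
      \<exists>l c. A = l *\<^sub>M mat2 1 0 b 0 + c *\<^sub>M mat 1"
  \<comment> \<open>The idempotent has diagonal (1, 0), so the diagonal of \<open>A\<close> dictates
    both coefficients.\<close>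
  by (rule exI[of _ "A $ 1 $ 1 - A $ 2 $ 2"], rule exI[of _ "A $ 2 $ 2"],
      (auto simp: matrix_2_simps algebra_simps)[1])+

lemma strong_k_commutativity_preserving_2x2:
  fixes \<Phi> :: "'a::field_char_0^2^2 \<Rightarrow> 'a^2^2"
  assumes k: "k \<ge> 1" and range: "{A. rank A = 1} \<subseteq> range \<Phi>"
    and pres: "strong_k_commutativity_preserving k \<Phi>"
  shows "\<exists>h l. l ^ (k + 1) = 1 \<and> (\<forall>A. \<Phi> A = l *\<^sub>M A + h A *\<^sub>M mat 1)"
proof -
  \<comment> \<open>\<open>E\<close>, \<open>F\<close>, \<open>G\<close> and the identity form a
    basis. \<open>H = 2F - E\<close> and \<open>K = 2G - E\<close> are further idempotents, on the
    affine lines through \<open>E\<close> and \<open>F\<close> and through \<open>E\<close> and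
    \<open>G\<close>.\<close>
  define E F G H K :: "'a^2^2"
    where "E = mat2 1 0 0 0" and "F = mat2 1 1 0 0" and "G = mat2 1 0 1 0"
      and "H = mat2 1 2 0 0" and "K = mat2 1 0 2 0"
  note defs = E_def F_def G_def H_def K_def
  have idem: "E ** E = E" "F ** F = F" "G ** G = G" "H ** H = H" "K ** K = K"
    by (simp_all add: defs matrix_2_simps)
  have comm: "\<Phi> P ** P = P ** \<Phi> P" if "P ** P = P" for P
    using k_commutator_idempotent that k strong_preserving_k_commutator_image_self[OF pres k] .
  obtain e f g p q e' f' g' p' q' where im:
    "\<Phi> E = e *\<^sub>M E + e' *\<^sub>M mat 1" "\<Phi> F = f *\<^sub>M F + f' *\<^sub>M mat 1"
    "\<Phi> G = g *\<^sub>M G + g' *\<^sub>M mat 1" "\<Phi> H = p *\<^sub>M H + p' *\<^sub>M mat 1"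
    "\<Phi> K = q *\<^sub>M K + q' *\<^sub>M mat 1"
    using idem[THEN comm] commute_mat2_imp_affine unfolding defs by meson
  \<comment> \<open>Such an \<open>X\<close> commutes with the rank one idempotents, all of which
    are values of \<open>\<Phi>\<close>. Commuting with \<open>E\<close> makes it diagonal, and with
    \<open>F\<close> equates the diagonal entries.\<close>
  have scalar: "X $ 1 $ 2 = 0 \<and> X $ 2 $ 1 = 0 \<and> X $ 1 $ 1 = X $ 2 $ 2"
    if X: "\<And>C. k_commutator k X (\<Phi> C) = 0" for X
  proof -
    have "X ** P = P ** X" if P: "rank P = 1" "P ** P = P" for P
    proof -
      obtain C where "P = \<Phi> C"
        using range P(1) by blast
      with X P(2) k show ?thesis
        by (metis k_commutator_idempotent)
    qed
    then have "X ** E = E ** X" "X ** F = F ** X"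
      using idem by (simp_all add: defs mat2_rank_1)
    then show ?thesis
      by (auto simp: matrix_2_simps defs)
  qed
  \<comment> \<open>Bracketing with \<open>\<Phi> C\<close> turns images into k-commutators with
    \<open>C\<close>, which are linear on the left and kill the identity; so the difference of the
    two sides is scalar.\<close>
  have lin: "\<exists>c. \<Phi> A = (a *\<^sub>M \<Phi> E + b *\<^sub>M \<Phi> F + d *\<^sub>M \<Phi> G) + c *\<^sub>M mat 1"
    if A: "A = a *\<^sub>M E + b *\<^sub>M F + d *\<^sub>M G + t *\<^sub>M mat 1" for A a b d t
  proof -
    let ?X = "\<Phi> A - (a *\<^sub>M \<Phi> E + b *\<^sub>M \<Phi> F + d *\<^sub>M \<Phi> G)"
    have "k_commutator k ?X (\<Phi> C) = 0" for C
      using pres k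
      by (simp add: strong_k_commutativity_preserving_def k_commutator_diff_left A
          k_commutator_add_left k_commutator_scale_left k_commutator_mat_1_left)
    from scalar[of ?X, OF this] show ?thesis
      by (intro exI[of _ "?X $ 2 $ 2"]) (simp add: vec_eq_iff forall_2 algebra_simps)
  qed
  have "H = (-1) *\<^sub>M E + 2 *\<^sub>M F + 0 *\<^sub>M G + 0 *\<^sub>M mat 1"
    by (simp add: defs vec_eq_iff forall_2)
  \<comment> \<open>Both quantities ignore the unknown scalar matrix. They read
    \<open>p = 2f - e\<close> and \<open>2p = 2f\<close>, whence \<open>f = e\<close>.\<close>
  from lin[OF this] have "\<Phi> H $ 1 $ 1 - \<Phi> H $ 2 $ 2
      = 2 * (\<Phi> F $ 1 $ 1 - \<Phi> F $ 2 $ 2) - (\<Phi> E $ 1 $ 1 - \<Phi> E $ 2 $ 2)"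
    and "\<Phi> H $ 1 $ 2 = 2 * \<Phi> F $ 1 $ 2 - \<Phi> E $ 1 $ 2"
    by auto
  then have fe: "f = e"
    unfolding im by (simp add: defs)
  have "K = (-1) *\<^sub>M E + 0 *\<^sub>M F + 2 *\<^sub>M G + 0 *\<^sub>M mat 1"
    by (simp add: defs vec_eq_iff forall_2)
  from lin[OF this] have "\<Phi> K $ 1 $ 1 - \<Phi> K $ 2 $ 2
      = 2 * (\<Phi> G $ 1 $ 1 - \<Phi> G $ 2 $ 2) - (\<Phi> E $ 1 $ 1 - \<Phi> E $ 2 $ 2)"
    and "\<Phi> K $ 2 $ 1 = 2 * \<Phi> G $ 2 $ 1 - \<Phi> E $ 2 $ 1"
    by auto
  then have ge: "g = e"
    unfolding im by (simp add: defs)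
  have "\<exists>c. \<Phi> A = e *\<^sub>M A + c *\<^sub>M mat 1" for A
  proof -
    \<comment> \<open>Only \<open>F\<close> and \<open>G\<close> have off-diagonal entries and only
      the identity has a (2,2) entry; \<open>E\<close> absorbs the rest of the (1,1) entry.\<close>
    have "A = (A $ 1 $ 1 - A $ 2 $ 2 - A $ 1 $ 2 - A $ 2 $ 1) *\<^sub>M E + A $ 1 $ 2 *\<^sub>M F
        + A $ 2 $ 1 *\<^sub>M G + A $ 2 $ 2 *\<^sub>M mat 1" (is "_ = ?a *\<^sub>M _ + ?b *\<^sub>M _ + ?d *\<^sub>M _ + ?t *\<^sub>M _")
      by (simp add: defs vec_eq_iff forall_2)
    from lin[OF this] obtain c
      where "\<Phi> A = ?a *\<^sub>M \<Phi> E + ?b *\<^sub>M \<Phi> F + ?d *\<^sub>M \<Phi> G + c *\<^sub>M mat 1" by blast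
    \<comment> \<open>The combination of \<open>E\<close>, \<open>F\<close>, \<open>G\<close> equals
      \<open>A\<close> minus \<open>?t\<close> times the identity, which explains the term
      \<open>- e * ?t\<close>.\<close>
    then have "\<Phi> A = e *\<^sub>M A + (?a * e' + ?b * f' + ?d * g' + c - e * ?t) *\<^sub>M mat 1"
      unfolding im fe ge by (simp add: defs vec_eq_iff forall_2 algebra_simps)
    then show ?thesis ..
  qed
  then obtain h where h: "\<And>A. \<Phi> A = e *\<^sub>M A + h A *\<^sub>M mat 1"
    by metis
  \<comment> \<open>One nonzero k-commutator determines the scalar: it is multiplied by
    \<open>e\<close> from the left argument and \<open>e ^ k\<close> from the right, yet
    preserved.\<close>
  let ?N = "mat2 0 1 0 0 :: 'a^2^2"
  have "k_commutator k (\<Phi> ?N) (\<Phi> E) = k_commutator k ?N E"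
    using pres by (simp add: strong_k_commutativity_preserving_def)
  then have "e ^ k *\<^sub>M e *\<^sub>M k_commutator k ?N E = k_commutator k ?N E"
    using k by (simp add: h k_commutator_affine_right k_commutator_add_left
        k_commutator_scale_left k_commutator_mat_1_left)
  then have "e ^ (k + 1) = 1"
    by (simp add: E_def k_commutator_mat2 vec_eq_iff forall_2 mult.commute)
  with h show ?thesis by blast
qed

lemma strong_k_commutativity_preserving_2x2_iff:
  fixes \<Phi> :: "'a::field_char_0^2^2 \<Rightarrow> 'a^2^2"
  assumes "k \<ge> 1" "{A. rank A = 1} \<subseteq> range \<Phi>"
  shows "strong_k_commutativity_preserving k \<Phi> \<longleftrightarrow>
      (\<exists>h l. l ^ (k + 1) = 1 \<and> (\<forall>A. \<Phi> A = l *\<^sub>M A + h A *\<^sub>M mat 1))"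
  by (rule iffI, erule strong_k_commutativity_preserving_2x2[OF assms], elim exE conjE,
      rule strong_k_commutativity_preserving_affine[OF assms(1)], assumption, erule spec)

theorem theorem1:
  fixes k :: nat
  assumes "k \<ge> 1"
  shows
    "(\<forall>\<Phi> :: real^2^2 \<Rightarrow> real^2^2. {A. rank A = 1} \<subseteq> range \<Phi> \<longrightarrow>
        (strong_k_commutativity_preserving k \<Phi> \<longleftrightarrow>
          (\<exists>(h :: real^2^2 \<Rightarrow> real) (l :: real). l ^ (k + 1) = 1 \<and>
             (\<forall>A. \<Phi> A = l *\<^sub>M A + h A *\<^sub>M mat 1))))
     \<and>
     (\<forall>\<Phi> :: complex^2^2 \<Rightarrow> complex^2^2. {A. rank A = 1} \<subseteq> range \<Phi> \<longrightarrow>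
        (strong_k_commutativity_preserving k \<Phi> \<longleftrightarrow>
          (\<exists>(h :: complex^2^2 \<Rightarrow> complex) (l :: complex). l ^ (k + 1) = 1 \<and>
             (\<forall>A. \<Phi> A = l *\<^sub>M A + h A *\<^sub>M mat 1))))"
  by (intro conjI allI impI strong_k_commutativity_preserving_2x2_iff assms)

end
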